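(* Let $F(X)$ be a finitely generated free group with finite free basis $X$, and let $H$ be any subgroup of $F(X)$. Then the limit $\alpha_H=\lim_{n\to\infty}\sqrt[n]{g_H(n)}$ exists, where $g_H(n)$ is the growth function of $H$ with respect to $X$.
   Context: For a subset $U\subset F(X)$, the (relative) growth function of $U$ with respect to $X$ is $g_U(n)=\#\{g\in U : |g|\le n\}$, $n=0,1,\dots$, where $|g|$ denotes the length of $g$ with respect to the free basis $X$. The limit $\alpha_H$ is called the exponential growth rate of $H$. *)

theory Defs
  imports Complex_Main "HOL-Algebra.Group"
begin

text \<open>A word over \<open>X\<close> is a list of letters \<open>(x, b)\<close> with \<open>x \<in> X\<close>; the letter \<open>(x, True)\<close> stands
  for \<open>x\<close> and \<open>(x, False)\<close> for its inverse.\<close>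

definition letter_value :: "('a, 'm) monoid_scheme \<Rightarrow> 'a \<times> bool \<Rightarrow> 'a" where
  "letter_value G l = (if snd l then fst l else inv\<^bsub>G\<^esub> (fst l))"

definition word_value :: "('a, 'm) monoid_scheme \<Rightarrow> ('a \<times> bool) list \<Rightarrow> 'a" where
  "word_value G w = foldr (\<lambda>l g. letter_value G l \<otimes>\<^bsub>G\<^esub> g) w \<one>\<^bsub>G\<^esub>"

definition reduced_words :: "'a set \<Rightarrow> ('a \<times> bool) list set" where
  "reduced_words X =
     {w \<in> lists (X \<times> UNIV). successively (\<lambda>l l'. \<not> (fst l = fst l' \<and> snd l \<noteq> snd l')) w}"

text \<open>\<open>X\<close> is a free basis of the group \<open>G\<close>: every element of \<open>G\<close> is the value of exactly one
  reduced word over \<open>X\<close>. (The universal property cannot be used as the definition, since it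
  quantifies over groups on all types.)\<close>

definition free_basis :: "('a, 'm) monoid_scheme \<Rightarrow> 'a set \<Rightarrow> bool" where
  "free_basis G X \<longleftrightarrow>
     X \<subseteq> carrier G \<and> (\<forall>g \<in> carrier G. \<exists>!w. w \<in> reduced_words X \<and> word_value G w = g)"

definition free_length :: "('a, 'm) monoid_scheme \<Rightarrow> 'a set \<Rightarrow> 'a \<Rightarrow> nat" where
  "free_length G X g = length (THE w. w \<in> reduced_words X \<and> word_value G w = g)"

definition growth_function :: "('a, 'm) monoid_scheme \<Rightarrow> 'a set \<Rightarrow> 'a set \<Rightarrow> nat \<Rightarrow> nat" where
  "growth_function G X U n = card {g \<in> U. free_length G X g \<le> n}"

end

theory Submission
  imports Defs "HOL-Library.Sublist" "HOL-Real_Asymp.Real_Asymp"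
begin

text \<open>
  If products of elements of \<open>H\<close> never cancelled, then the growth function \<open>g\<close> of \<open>H\<close> would
  satisfy \<open>g m * g n \<le> (m + 1) * g (m + n)\<close>, because a product is determined by its word together
  with the place where the two factors meet, and a Fekete-type argument would yield the limit. The
  idea is to prevent cancellation by inserting between two factors \<open>v\<close> and \<open>w\<close> a connecting
  element of \<open>H\<close>, chosen from a fixed finite set \<open>T\<close> so that \<open>v @ t @ w\<close> is reduced. This costs only
  a constant factor and a bounded shift of the radius:
  \<open>g m * g n \<le> K * (m + 1) * g (m + n + c)\<close> (lemma \<open>supermult_of_connectors\<close>), which still
  suffices for convergence (lemma \<open>root_tendsto_of_quasi_supermult\<close>).

  To find \<open>T\<close>, replace \<open>H \<noteq> {\<one>}\<close> by a conjugate containing a cyclically reduced word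
  \<open>h = x \<dots> y\<^sup>-\<^sup>1\<close>, where \<open>x \<noteq> y\<close>; conjugation changes lengths by a bounded amount. Given \<open>v\<close> and \<open>w\<close>,
  at least one of \<open>x\<close>, \<open>y\<close> can follow \<open>v\<close>, and at least one of \<open>x\<^sup>-\<^sup>1\<close>, \<open>y\<^sup>-\<^sup>1\<close> can precede \<open>w\<close>. So it
  suffices to have in \<open>H\<close> a word for each of the four combinations of these ends. The words \<open>h\<close> and
  \<open>h\<^sup>-\<^sup>1\<close> realise \<open>x \<dots> y\<^sup>-\<^sup>1\<close> and \<open>y \<dots> x\<^sup>-\<^sup>1\<close>. For \<open>x \<dots> x\<^sup>-\<^sup>1\<close> take \<open>h\<^sup>N u h\<^sup>-\<^sup>N\<close> with \<open>u \<in> H\<close> and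
  \<open>N\<close> larger than the length of \<open>u\<close>: cancellation stops before reaching the outer letters unless \<open>u\<close>
  is used up entirely, that is, \<open>u\<close> is the product of the inverse of a suffix of \<open>h\<^sup>N\<close> and a suffix of
  \<open>h\<^sup>N\<close>. There are at most \<open>(n + 1)\<^sup>2\<close> such \<open>u\<close> of length at most \<open>n\<close>
  (lemma \<open>exists_word_with_inverse_ends\<close>). The combination \<open>y \<dots> y\<^sup>-\<^sup>1\<close> arises likewise from
  \<open>h\<^sup>-\<^sup>1\<close>. Hence the connectors exist as soon as the ball of some radius \<open>n\<close> has more than
  \<open>(n + 1)\<^sup>2\<close> elements. Otherwise the growth is at most quadratic and the limit is \<open>1\<close>; this
  dichotomy by growth also disposes of cyclic subgroups.
\<close>

section \<open>Quasi-supermultiplicative sequences\<close>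

text \<open>A variant of Fekete's lemma. With \<open>a m = g m / (K * (m + 1))\<close>, iterating the inequality with \<open>m\<close>
  fixed gives \<open>a m ^ q \<le> g (q * (m + c))\<close>: the factor \<open>m + 1\<close> does not grow with \<open>q\<close>. By
  monotonicity, \<open>ln (g n) / n\<close> is therefore eventually almost at least \<open>ln (a m) / (m + c)\<close>, for
  every \<open>m\<close>. In the other direction, \<open>ln (g n)\<close> and \<open>ln (a n)\<close> differ only by a logarithmic term, so
  \<open>ln (g n) / n\<close> tends to the supremum of these quotients.\<close>

lemma root_tendsto_of_quasi_supermult:
  fixes g :: "nat \<Rightarrow> real" and B K :: real and c :: nat
  assumes mono: "mono g"
    and ge1: "\<And>n. 1 \<le> g n"
    and le: "\<And>n. g n \<le> B ^ n"
    and "K > 0"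
    and supermult: "\<And>m n. g m * g n \<le> K * real (m + 1) * g (m + n + c)"
  shows "\<exists>\<alpha>. (\<lambda>n. root n (g n)) \<longlonglongrightarrow> \<alpha>"
proof -
  define a where "a m = g m / (K * real (m + 1))" for m
  have gpos: "g n > 0" for n
    using ge1[of n] by linarith
  have apos: "a m > 0" for m
    unfolding a_def using gpos[of m] \<open>K > 0\<close> by simp
  have iter: "a m ^ q \<le> g (q * (m + c))" for m q
  proof (induction q)
    case 0
    then show ?case using ge1[of 0] by simp
  next
    case (Suc q)
    have "a m ^ Suc q \<le> a m * g (q * (m + c))"
      using Suc apos[of m] by (simp add: mult_left_mono)
    also have "\<dots> \<le> g (m + q * (m + c) + c)"
      using supermult[of m "q * (m + c)"] \<open>K > 0\<close>
      unfolding a_def by (simp add: pos_divide_le_eq mult_ac)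
    also have "m + q * (m + c) + c = Suc q * (m + c)" by simp
    finally show ?case .
  qed
  define b where "b m = ln (a m) / real (m + c)" for m
  define \<beta> where "\<beta> = Sup (b ` {1..})"
  have B1: "B \<ge> 1"
    using ge1[of 1] le[of 1] by simp
  have ln_g_le: "ln (g n) \<le> real n * ln B" for n
    using ln_le_cancel_iff[of "g n" "B ^ n"] gpos[of n] le[of n] B1
    by (simp add: ln_realpow)
  have ln_a: "ln (g m) = ln (a m) + ln (K * real (m + 1))" for m
    unfolding a_def using gpos[of m] \<open>K > 0\<close> by (simp add: ln_div)
  have lower: "b m - \<bar>ln (a m)\<bar> / real n \<le> ln (g n) / real n"
    if "m \<ge> 1" "n \<ge> 1" for m n
  proof -
    define d where "d = m + c"
    have "d > 0" using that d_def by simp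
    define q where "q = n div d"
    have nq: "n = q * d + n mod d" unfolding q_def by simp
    have "q * d \<le> n" using nq by linarith
    then have "a m ^ q \<le> g n"
      using iter[of m q] monoD[OF mono, of "q * d" n] unfolding d_def by linarith
    then have "ln (a m ^ q) \<le> ln (g n)"
      using apos[of m] gpos[of n] by simp
    then have 1: "real q * ln (a m) \<le> ln (g n)"
      using apos[of m] by (simp add: ln_realpow)
    have "real n = real q * real d + real (n mod d)"
      by (metis nq of_nat_add of_nat_mult)
    then have e: "real n / real d - real q = real (n mod d) / real d"
      using \<open>d > 0\<close> by (simp add: field_simps)
    \<comment> \<open>\<open>ln (a m)\<close> may be negative, so rounding \<open>n / d\<close> down is charged with its absolute value.\<close>
    have "0 \<le> real n / real d - real q" "real n / real d - real q \<le> 1"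
      unfolding e using \<open>d > 0\<close> by (auto simp: less_imp_le)
    then have "(real n / real d - real q) * ln (a m) \<le> (real n / real d - real q) * \<bar>ln (a m)\<bar>"
      and "(real n / real d - real q) * \<bar>ln (a m)\<bar> \<le> 1 * \<bar>ln (a m)\<bar>"
      by (auto intro!: mult_left_mono mult_right_mono simp del: mult_1 mult_le_cancel_right2)
    then have "(real n / real d - real q) * ln (a m) \<le> \<bar>ln (a m)\<bar>"
      by (simp only: mult_1) (rule order_trans)
    then have "real n * b m - \<bar>ln (a m)\<bar> \<le> ln (g n)"
      using 1 unfolding b_def d_def by (simp add: algebra_simps)
    then have "(real n * b m - \<bar>ln (a m)\<bar>) / real n \<le> ln (g n) / real n"
      by (rule divide_right_mono) simp
    then show ?thesis
      using that by (simp add: diff_divide_distrib)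
  qed
  have bdd: "bdd_above (b ` {1..})"
  proof (rule bdd_aboveI2)
    fix m :: nat assume "m \<in> {1..}"
    then have m: "m \<ge> 1" by simp
    have "(\<lambda>n. b m - \<bar>ln (a m)\<bar> / real n) \<longlonglongrightarrow> b m" by real_asymp
    moreover have "b m - \<bar>ln (a m)\<bar> / real n \<le> ln B" if "n \<ge> 1" for n
    proof -
      have "ln (g n) / real n \<le> ln B"
        using ln_g_le[of n] that by (simp add: field_simps)
      with lower[OF m that] show ?thesis by linarith
    qed
    ultimately show "b m \<le> ln B"
      using LIMSEQ_le_const2[of "\<lambda>n. b m - \<bar>ln (a m)\<bar> / real n" "b m" "ln B"] by blast
  qed
  have b_le: "b m \<le> \<beta>" if "m \<ge> 1" for m
    unfolding \<beta>_def using that bdd by (intro cSup_upper) auto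
  have "(\<lambda>n. ln (g n) / real n) \<longlonglongrightarrow> \<beta>"
  proof (rule order_tendstoI)
    fix y assume "y < \<beta>"
    have "b ` {1..} \<noteq> {}" by simp
    from less_cSupD[OF this \<open>y < \<beta>\<close>[unfolded \<beta>_def]]
    obtain m where m: "m \<ge> 1" "y < b m"
      by (elim bexE imageE) simp
    have "(\<lambda>n. b m - \<bar>ln (a m)\<bar> / real n) \<longlonglongrightarrow> b m" by real_asymp
    then have "\<forall>\<^sub>F n in sequentially. y < b m - \<bar>ln (a m)\<bar> / real n"
      using m(2) by (rule order_tendstoD)
    then show "\<forall>\<^sub>F n in sequentially. y < ln (g n) / real n"
      using eventually_ge_at_top[of 1] by eventually_elim (use lower[OF m(1)] in fastforce)
  next
    fix y assume y: "\<beta> < y"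
    have "(\<lambda>n. (\<beta> * real (n + c) + ln (K * real (n + 1))) / real n) \<longlonglongrightarrow> \<beta>"
      using \<open>K > 0\<close> by real_asymp
    then have "\<forall>\<^sub>F n in sequentially. (\<beta> * real (n + c) + ln (K * real (n + 1))) / real n < y"
      using y by (rule order_tendstoD)
    then show "\<forall>\<^sub>F n in sequentially. ln (g n) / real n < y"
      using eventually_ge_at_top[of 1]
    proof eventually_elim
      case (elim n)
      have "ln (a n) \<le> \<beta> * real (n + c)"
        using b_le[of n] elim unfolding b_def by (simp add: field_simps)
      then have "ln (g n) \<le> \<beta> * real (n + c) + ln (K * real (n + 1))"
        unfolding ln_a by simp
      then have "ln (g n) / real n \<le> (\<beta> * real (n + c) + ln (K * real (n + 1))) / real n"
        by (simp add: divide_right_mono)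
      then show ?case using elim by linarith
    qed
  qed
  then have "(\<lambda>n. exp (ln (g n) / real n)) \<longlonglongrightarrow> exp \<beta>"
    by (rule tendsto_exp)
  moreover have "\<forall>\<^sub>F n in sequentially. exp (ln (g n) / real n) = root n (g n)"
    using eventually_gt_at_top[of 0]
    by eventually_elim (simp add: root_powr_inverse powr_def gpos less_imp_le less_imp_neq[OF gpos, symmetric])
  ultimately show ?thesis
    by (intro exI[of _ "exp \<beta>"]) (rule Lim_transform_eventually)
qed

lemma root_tendsto_1_of_quadratic:
  fixes g :: "nat \<Rightarrow> real" and d :: real
  assumes "\<And>n. 1 \<le> g n" and "\<And>n. g n \<le> (real n + d)\<^sup>2" and "d > 0"
  shows "(\<lambda>n. root n (g n)) \<longlonglongrightarrow> 1"
proof (rule tendsto_sandwich)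
  show "\<forall>\<^sub>F n in sequentially. 1 \<le> root n (g n)"
    using eventually_gt_at_top[of 0] by eventually_elim (use assms(1) in simp)
  show "\<forall>\<^sub>F n in sequentially. root n (g n) \<le> ((real n + d)\<^sup>2) powr (1 / real n)"
    using eventually_gt_at_top[of 0]
  proof eventually_elim
    case (elim n)
    have "root n (g n) \<le> root n ((real n + d)\<^sup>2)"
      using elim assms(2) by simp
    also have "\<dots> = ((real n + d)\<^sup>2) powr (1 / real n)"
      using elim assms(3) by (simp add: root_powr_inverse)
    finally show ?case .
  qed
  show "(\<lambda>n. ((real n + d)\<^sup>2) powr (1 / real n)) \<longlonglongrightarrow> 1"
    using \<open>d > 0\<close> by real_asymp
qed simp

section \<open>Reduced words\<close>

definition inv_letter :: "'a \<times> bool \<Rightarrow> 'a \<times> bool" where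
  "inv_letter l = (fst l, \<not> snd l)"

definition inv_word :: "('a \<times> bool) list \<Rightarrow> ('a \<times> bool) list" where
  "inv_word w = rev (map inv_letter w)"

lemma inv_letter_inv_letter [simp]: "inv_letter (inv_letter l) = l"
  by (simp add: inv_letter_def)

lemma inv_letter_eq_iff [simp]: "inv_letter l = inv_letter l' \<longleftrightarrow> l = l'"
  by (metis inv_letter_inv_letter)

lemma inv_letter_neq [simp]: "inv_letter l \<noteq> l"
  by (simp add: inv_letter_def prod_eq_iff)

lemma inv_word_simps [simp]:
  "inv_word [] = []"
  "inv_word (u @ v) = inv_word v @ inv_word u"
  "inv_word [l] = [inv_letter l]"
  "inv_word (inv_word w) = w"
  "length (inv_word w) = length w"
  "inv_word w = [] \<longleftrightarrow> w = []"
  by (auto simp: inv_word_def rev_map comp_def)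

lemma hd_inv_word: "w \<noteq> [] \<Longrightarrow> hd (inv_word w) = inv_letter (last w)"
  by (simp add: inv_word_def hd_rev last_map)

lemma last_inv_word: "w \<noteq> [] \<Longrightarrow> last (inv_word w) = inv_letter (hd w)"
  by (simp add: inv_word_def last_rev hd_map)

lemma reduced_words_iff:
  "w \<in> reduced_words X \<longleftrightarrow>
     w \<in> lists (X \<times> UNIV) \<and> successively (\<lambda>l l'. l' \<noteq> inv_letter l) w"
proof -
  have eq: "(\<lambda>l l'. \<not> (fst l = fst l' \<and> snd l \<noteq> snd l')) = (\<lambda>l l'. l' \<noteq> inv_letter l)"
    by (auto simp: fun_eq_iff inv_letter_def)
  show ?thesis by (simp only: reduced_words_def mem_Collect_eq eq)
qed

lemma Nil_reduced [simp]: "[] \<in> reduced_words X"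
  by (simp add: reduced_words_iff)

lemma reduced_append_iff:
  "u @ v \<in> reduced_words X \<longleftrightarrow> u \<in> reduced_words X \<and> v \<in> reduced_words X \<and>
     (u \<noteq> [] \<longrightarrow> v \<noteq> [] \<longrightarrow> hd v \<noteq> inv_letter (last u))"
  by (auto simp: reduced_words_iff successively_append_iff)

lemma inv_word_lists [simp]: "inv_word w \<in> lists (X \<times> UNIV) \<longleftrightarrow> w \<in> lists (X \<times> UNIV)"
  by (induction w) (auto simp: inv_word_def inv_letter_def)

lemma inv_word_reduced [simp]: "w \<in> reduced_words X \<Longrightarrow> inv_word w \<in> reduced_words X"
proof (induction w)
  case (Cons l w)
  then have l: "[l] @ w \<in> reduced_words X" by simp
  then have "inv_word w \<in> reduced_words X" "inv_word [l] \<in> reduced_words X"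
    using Cons unfolding reduced_append_iff
    by (auto simp: reduced_words_iff inv_letter_def)
  with l have "inv_word w @ inv_word [l] \<in> reduced_words X"
    unfolding reduced_append_iff by (auto simp: last_inv_word)
  then show ?case by (metis inv_word_simps(2) append_Cons append_Nil)
qed simp

lemma reduced_power:
  assumes "h \<in> reduced_words X" "h \<noteq> []" "hd h \<noteq> inv_letter (last h)"
  shows "concat (replicate N h) \<in> reduced_words X"
proof (induction N)
  case (Suc N)
  have "hd (concat (replicate N h)) = hd h" if "concat (replicate N h) \<noteq> []"
    using that assms(2) by (cases N) auto
  then show ?case using Suc assms by (simp add: reduced_append_iff)
qed simp

text \<open>The cancellation in \<open>P @ u @ inv_word P\<close>: \<open>A\<close> is the part of \<open>u\<close> cancelled from the left and \<open>C\<close>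
  the part cancelled from the right. If \<open>u\<close> is not exhausted by two such parts, then choosing them
  with the shortest possible middle \<open>B\<close> leaves a nonempty \<open>B\<close>, and minimality says precisely that
  no further letter cancels on either side of it. As \<open>u\<close> is shorter than \<open>P\<close>, neither copy of \<open>P\<close> is
  used up.\<close>

lemma exists_maximal_peeling:
  assumes "u \<in> reduced_words X" "P \<in> reduced_words X" "length u < length P"
    and not_product: "\<And>A C. u = A @ C \<Longrightarrow> suffix (inv_word A) P \<Longrightarrow> \<not> suffix C P"
  obtains A B C P1 P2 where "u = A @ B @ C" "P = P1 @ inv_word A" "P = P2 @ C"
    "P1 \<noteq> []" "P2 \<noteq> []" "P1 @ B @ inv_word P2 \<in> reduced_words X"
proof -
  define peel where "peel B \<longleftrightarrow>
    (\<exists>A C. u = A @ B @ C \<and> suffix (inv_word A) P \<and> suffix C P)" for B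
  have "peel u" unfolding peel_def by (intro exI[of _ "[]"]) auto
  then obtain B where B: "peel B" and min: "\<And>B'. peel B' \<Longrightarrow> length B \<le> length B'"
    using ex_has_least_nat[of peel u length] by blast
  obtain A C where u: "u = A @ B @ C" and sA: "suffix (inv_word A) P" and sC: "suffix C P"
    using B unfolding peel_def by blast
  have "B \<noteq> []" using not_product[of A C] u sA sC by auto
  obtain P1 where P1: "P = P1 @ inv_word A" using sA by (auto simp: suffix_def)
  obtain P2 where P2: "P = P2 @ C" using sC by (auto simp: suffix_def)
  have ne: "P1 \<noteq> []" "P2 \<noteq> []" using P1 P2 u assms(3) by auto
  have j1: "hd B \<noteq> inv_letter (last P1)"
  proof
    assume eq: "hd B = inv_letter (last P1)"
    have "P = butlast P1 @ inv_word (A @ [hd B])"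
      using P1 ne eq by simp
    then have "suffix (inv_word (A @ [hd B])) P" by (metis suffixI)
    moreover have "u = (A @ [hd B]) @ tl B @ C" using u \<open>B \<noteq> []\<close> by simp
    ultimately have "peel (tl B)" using sC unfolding peel_def by blast
    from min[OF this] \<open>B \<noteq> []\<close> show False by (cases B) auto
  qed
  have j2: "last P2 \<noteq> last B"
  proof
    assume eq: "last P2 = last B"
    have "P = butlast P2 @ (last B # C)"
      using P2 ne eq[symmetric] by simp
    then have "suffix (last B # C) P" by (metis suffixI)
    moreover have "u = A @ butlast B @ (last B # C)" using u \<open>B \<noteq> []\<close> by simp
    ultimately have "peel (butlast B)" using sA unfolding peel_def by blast
    from min[OF this] \<open>B \<noteq> []\<close> show False by (cases B rule: rev_cases) auto
  qed
  have "B \<in> reduced_words X"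
    using assms(1) unfolding u reduced_append_iff by blast
  moreover have "P1 \<in> reduced_words X"
    using assms(2) unfolding P1 reduced_append_iff by blast
  moreover have "P2 \<in> reduced_words X"
    using assms(2) unfolding P2 reduced_append_iff by blast
  ultimately have "P1 @ B @ inv_word P2 \<in> reduced_words X"
    using j1 j2 ne \<open>B \<noteq> []\<close> by (auto simp: reduced_append_iff hd_inv_word)
  with that u P1 P2 ne show ?thesis by blast
qed

section \<open>Words in a free group\<close>

text \<open>Uniqueness of reduced words identifies \<open>G\<close> with the set of reduced words over \<open>X\<close>; counting is
  done with words, and algebra with their values.\<close>

locale free_group = group G for G (structure) +
  fixes X :: "'a set"
  assumes basis: "free_basis G X"
begin

abbreviation words :: "('a \<times> bool) list set" where
  "words \<equiv> lists (X \<times> UNIV)"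

abbreviation val :: "('a \<times> bool) list \<Rightarrow> 'a" where
  "val \<equiv> word_value G"

abbreviation len :: "'a \<Rightarrow> nat" where
  "len \<equiv> free_length G X"

definition word_ball :: "'a set \<Rightarrow> nat \<Rightarrow> ('a \<times> bool) list set" where
  "word_ball H n = {w \<in> reduced_words X. val w \<in> H \<and> length w \<le> n}"

lemma inv_mult_cancel:
  "x \<in> carrier G \<Longrightarrow> y \<in> carrier G \<Longrightarrow> inv x \<otimes> (x \<otimes> y) = y"
  "x \<in> carrier G \<Longrightarrow> y \<in> carrier G \<Longrightarrow> x \<otimes> (inv x \<otimes> y) = y"
  by (simp_all flip: m_assoc)

lemma reduced_subset_words: "w \<in> reduced_words X \<Longrightarrow> w \<in> words"
  by (simp add: reduced_words_iff)

lemma letter_value_closed [simp]: "fst l \<in> X \<Longrightarrow> letter_value G l \<in> carrier G"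
  using basis by (auto simp: free_basis_def letter_value_def)

lemma letter_value_inv: "fst l \<in> X \<Longrightarrow> letter_value G (inv_letter l) = inv (letter_value G l)"
  using basis by (auto simp: free_basis_def letter_value_def inv_letter_def)

lemma val_Nil [simp]: "val [] = \<one>"
  and val_Cons: "val (l # w) = letter_value G l \<otimes> val w"
  by (simp_all add: word_value_def)

lemma val_closed [simp]: "w \<in> words \<Longrightarrow> val w \<in> carrier G"
  by (induction w) (simp_all add: val_Cons mem_Times_iff)

lemma val_append: "u \<in> words \<Longrightarrow> v \<in> words \<Longrightarrow> val (u @ v) = val u \<otimes> val v"
  by (induction u) (simp_all add: val_Cons m_assoc mem_Times_iff)

lemma val_inv_word: "w \<in> words \<Longrightarrow> val (inv_word w) = inv (val w)"
proof (induction w)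
  case (Cons l w)
  then have l: "fst l \<in> X" "w \<in> words" by auto
  have "inv_word (l # w) = inv_word w @ [inv_letter l]"
    by (simp add: inv_word_def)
  moreover have "val [inv_letter l] = inv (letter_value G l)"
    using l by (simp add: val_Cons letter_value_inv)
  moreover have "[inv_letter l] \<in> words"
    using l by (auto simp: inv_letter_def)
  ultimately show ?case
    using Cons l by (simp add: val_append val_Cons inv_mult_group)
qed simp

lemma ex1_reduced: "g \<in> carrier G \<Longrightarrow> \<exists>!w. w \<in> reduced_words X \<and> val w = g"
  using basis by (auto simp: free_basis_def)

lemma val_inj: "inj_on val (reduced_words X)"
  by (rule inj_onI) (metis ex1_reduced val_closed reduced_subset_words)

lemma len_val: "w \<in> reduced_words X \<Longrightarrow> len (val w) = length w"
proof -
  assume w: "w \<in> reduced_words X"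
  then have "(THE w'. w' \<in> reduced_words X \<and> val w' = val w) = w"
    by (intro the1_equality ex1_reduced) (simp_all add: reduced_subset_words)
  then show ?thesis by (simp add: free_length_def)
qed

lemma val_image_word_ball:
  assumes "H \<subseteq> carrier G"
  shows "val ` word_ball H n = {g \<in> H. len g \<le> n}"
proof (intro equalityI subsetI)
  fix g assume "g \<in> {g \<in> H. len g \<le> n}"
  moreover from this obtain w where "w \<in> reduced_words X" "val w = g"
    using ex1_reduced assms by blast
  ultimately show "g \<in> val ` word_ball H n"
    by (auto simp: word_ball_def len_val intro!: image_eqI[of _ _ w])
qed (auto simp: word_ball_def len_val)

lemma growth_function_eq:
  assumes "H \<subseteq> carrier G"
  shows "growth_function G X H n = card (word_ball H n)"
proof -
  have "inj_on val (word_ball H n)"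
    using val_inj by (rule inj_on_subset) (auto simp: word_ball_def)
  then show ?thesis
    unfolding growth_function_def val_image_word_ball[OF assms, symmetric]
    by (rule card_image)
qed

text \<open>Deleting two adjacent inverse letters does not change the value.\<close>

lemma not_reduced_shorten:
  assumes "w \<in> words" "w \<notin> reduced_words X"
  obtains w' where "w' \<in> words" "length w' < length w" "val w' = val w"
proof -
  have "\<exists>p l q. w = p @ [l, inv_letter l] @ q"
    using assms
  proof (induction rule: lists.induct)
    case (Cons a w)
    show ?case
    proof (cases "w \<in> reduced_words X")
      case True
      have "[a] \<in> words" using Cons.hyps by simp
      then have "[a] \<in> reduced_words X" by (simp add: reduced_words_iff)
      moreover have "[a] @ w \<notin> reduced_words X" using Cons.prems by simp
      ultimately have "w \<noteq> [] \<and> hd w = inv_letter a"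
        using True unfolding reduced_append_iff by auto
      then have "a # w = [] @ [a, inv_letter a] @ tl w"
        by (cases w) auto
      then show ?thesis by blast
    next
      case False
      then obtain p l q where "w = p @ [l, inv_letter l] @ q"
        using Cons.IH by blast
      then have "a # w = (a # p) @ [l, inv_letter l] @ q" by simp
      then show ?thesis by blast
    qed
  qed simp
  then obtain p l q where w: "w = p @ [l, inv_letter l] @ q" by blast
  then have in_words: "p \<in> words" "q \<in> words" "fst l \<in> X" "[l, inv_letter l] \<in> words"
    using assms(1) by auto
  have "val [l, inv_letter l] = \<one>"
    using in_words by (simp add: val_Cons letter_value_inv)
  then have "val w = val (p @ q)"
    using in_words by (simp add: w val_append del: append.simps)
  then show ?thesis
    using that[of "p @ q"] in_words w by auto
qed

lemma len_val_le: "w \<in> words \<Longrightarrow> len (val w) \<le> length w"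
proof (induction "length w" arbitrary: w rule: less_induct)
  case less
  show ?case
  proof (cases "w \<in> reduced_words X")
    case True
    then show ?thesis by (simp add: len_val)
  next
    case False
    then obtain w' where "w' \<in> words" "length w' < length w" "val w' = val w"
      using not_reduced_shorten less by blast
    then show ?thesis using less(1)[of w'] by simp
  qed
qed

lemma len_mult_le:
  assumes "g \<in> carrier G" "h \<in> carrier G"
  shows "len (g \<otimes> h) \<le> len g + len h"
proof -
  obtain u v where "u \<in> reduced_words X" "val u = g" "v \<in> reduced_words X" "val v = h"
    using ex1_reduced assms by metis
  then show ?thesis
    using len_val_le[of "u @ v"] len_val[of u] len_val[of v]
    by (auto simp: val_append reduced_subset_words)
qed

lemma len_inv:
  assumes "g \<in> carrier G"
  shows "len (inv g) = len g"
proof -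
  obtain u where "u \<in> reduced_words X" "val u = g"
    using ex1_reduced assms by metis
  then show ?thesis
    using len_val[of "inv_word u"] len_val[of u]
    by (auto simp: val_inv_word reduced_subset_words)
qed

lemma word_ball_subset: "word_ball H n \<subseteq> {w. set w \<subseteq> X \<times> UNIV \<and> length w \<le> n}"
  by (auto simp: word_ball_def reduced_words_iff in_lists_conv_set)

lemma finite_word_ball: "finite X \<Longrightarrow> finite (word_ball H n)"
  by (rule finite_subset[OF word_ball_subset finite_lists_length_le]) auto

lemma card_word_ball_le:
  assumes "finite X"
  shows "card (word_ball H n) \<le> (2 * card X + 1) ^ n"
proof -
  have "card (word_ball H n) \<le> card {w. set w \<subseteq> X \<times> (UNIV :: bool set) \<and> length w \<le> n}"
    using assms by (intro card_mono[OF _ word_ball_subset] finite_lists_length_le) auto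
  also have "\<dots> = (\<Sum>i\<le>n. (2 * card X) ^ i)"
    using assms by (subst card_lists_length_le) (auto simp: card_cartesian_product mult.commute)
  also have "\<dots> \<le> (2 * card X + 1) ^ n"
  proof (induction n)
    case (Suc n)
    have "(2 * card X) ^ Suc n \<le> 2 * card X * (2 * card X + 1) ^ n"
      unfolding power_Suc by (intro mult_le_mono2 power_mono) auto
    moreover have "(2 * card X + 1) ^ Suc n
        = (2 * card X + 1) ^ n + 2 * card X * (2 * card X + 1) ^ n"
      by (simp add: algebra_simps)
    ultimately show ?case
      using Suc unfolding sum.atMost_Suc by linarith
  qed simp
  finally show ?thesis .
qed

lemma card_word_ball_pos:
  assumes "finite X" "subgroup H G"
  shows "1 \<le> card (word_ball H n)"
proof -
  have "[] \<in> word_ball H n"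
    using assms(2) by (simp add: word_ball_def subgroup.one_closed)
  then have "card (word_ball H n) \<noteq> 0"
    using finite_word_ball[OF assms(1)] by auto
  then show ?thesis by simp
qed

section \<open>Connecting words\<close>

text \<open>The word \<open>t\<close> is the reduced form of \<open>P u P\<^sup>-\<^sup>1\<close>, where \<open>P\<close> is a power of \<open>h\<close> longer than all words
  \<open>u\<close> in the ball. A word \<open>u\<close> that cancels completely is a product of an inverted suffix of \<open>P\<close> and
  a suffix of \<open>P\<close>, hence is determined by the lengths of these two suffixes, both at most \<open>n\<close>. The
  assumption on the ball provides a \<open>u\<close> that is not of this kind.\<close>

lemma exists_word_with_inverse_ends:
  assumes H: "subgroup H G"
    and h: "h \<in> reduced_words X" "val h \<in> H" "h \<noteq> []" "hd h \<noteq> inv_letter (last h)"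
    and big: "(n + 1)\<^sup>2 < card (word_ball H n)"
  obtains t where "t \<in> reduced_words X" "val t \<in> H" "t \<noteq> []"
    "hd t = hd h" "last t = inv_letter (hd h)"
proof -
  define P where "P = concat (replicate (n + 1) h)"
  have P_red: "P \<in> reduced_words X"
    unfolding P_def using h by (intro reduced_power)
  have P_len: "n < length P"
  proof -
    have "length P = (n + 1) * length h"
      by (simp add: P_def length_concat sum_list_replicate)
    moreover have "length h \<ge> 1" using h by (cases h) auto
    then have "n + 1 \<le> (n + 1) * length h"
      using mult_le_mono2[of 1 "length h" "n + 1"] by simp
    ultimately show ?thesis by linarith
  qed
  have hd_P: "hd P = hd h" using h by (simp add: P_def)
  have h_words: "h \<in> words" using h reduced_subset_words by simp
  have P_H: "val P \<in> H"
  proof -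
    have "val (concat (replicate k h)) \<in> H \<and> concat (replicate k h) \<in> words" for k
      using h_words h(2) H
      by (induction k) (auto simp: val_append subgroup.one_closed subgroup.m_closed)
    then show ?thesis unfolding P_def by blast
  qed
  \<comment> \<open>\<open>f\<close> rebuilds a completely cancelling word from the lengths of its two parts.\<close>
  define f where "f = (\<lambda>(i, j). inv_word (drop (length P - i) P) @ drop (length P - j) P)"
  have drop_suffix: "drop (length P - length s) P = s" if "suffix s P" for s
    using that by (auto simp: suffix_def)
  have "card (f ` ({..n} \<times> {..n})) \<le> (n + 1)\<^sup>2"
    using card_image_le[of "{..n} \<times> {..n}" f] by (simp add: power2_eq_square)
  then have "\<not> word_ball H n \<subseteq> f ` ({..n} \<times> {..n})"
    using big card_mono[of "f ` ({..n} \<times> {..n})" "word_ball H n"]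
    by (meson finite_SigmaI finite_atMost finite_imageI leD le_trans)
  then obtain u where u: "u \<in> word_ball H n" "u \<notin> f ` ({..n} \<times> {..n})" by blast
  have not_product: "\<not> suffix C P" if "u = A @ C" "suffix (inv_word A) P" for A C
  proof
    assume "suffix C P"
    then have "f (length A, length C) = u"
      using that(1) drop_suffix[OF that(2)] drop_suffix[of C] by (simp add: f_def)
    moreover have "length A \<le> n" "length C \<le> n"
      using u(1) that by (auto simp: word_ball_def)
    ultimately show False using u(2) by (metis SigmaI atMost_iff image_eqI)
  qed
  have u_red: "u \<in> reduced_words X" and u_len: "length u < length P" and u_H: "val u \<in> H"
    using u(1) P_len by (auto simp: word_ball_def)
  obtain A B C P1 P2 where dec: "u = A @ B @ C" "P = P1 @ inv_word A" "P = P2 @ C"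
    "P1 \<noteq> []" "P2 \<noteq> []" and red: "P1 @ B @ inv_word P2 \<in> reduced_words X"
    by (rule exists_maximal_peeling[OF u_red P_red u_len not_product])
  define t where "t = P1 @ B @ inv_word P2"
  have w: "A \<in> words" "B \<in> words" "C \<in> words" "P1 \<in> words" "P2 \<in> words"
    using reduced_subset_words[OF u_red, unfolded dec(1)]
      reduced_subset_words[OF P_red, unfolded dec(2)]
      reduced_subset_words[OF P_red, unfolded dec(3)] by simp_all
  have val_P1: "val P = val P1 \<otimes> inv (val A)"
    unfolding dec(2) using w by (simp add: val_append val_inv_word)
  have val_P2: "val P = val P2 \<otimes> val C"
    unfolding dec(3) using w by (simp add: val_append)
  have "val t = val P \<otimes> val u \<otimes> inv (val P)"
  proof -
    have "val P \<otimes> val u = val P1 \<otimes> (inv (val A) \<otimes> val A) \<otimes> val B \<otimes> val C"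
      unfolding val_P1 dec(1) using w by (simp add: val_append m_assoc inv_mult_cancel)
    also have "\<dots> = val P1 \<otimes> val B \<otimes> val C" using w by simp
    finally have 1: "val P \<otimes> val u = val P1 \<otimes> val B \<otimes> val C" .
    have 2: "inv (val P) = inv (val C) \<otimes> inv (val P2)"
      unfolding val_P2 using w by (simp add: inv_mult_group)
    have "val P \<otimes> val u \<otimes> inv (val P)
        = val P1 \<otimes> val B \<otimes> (val C \<otimes> inv (val C)) \<otimes> inv (val P2)"
      unfolding 1 2 using w by (simp add: m_assoc inv_mult_cancel)
    also have "\<dots> = val P1 \<otimes> val B \<otimes> inv (val P2)" using w by simp
    also have "\<dots> = val t"
      unfolding t_def using w by (simp add: val_append val_inv_word m_assoc)
    finally show ?thesis by simp
  qed
  then have "val t \<in> H"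
    using H P_H u_H by (simp add: subgroup.m_closed subgroup.m_inv_closed)
  moreover have "hd P1 = hd h" "hd P2 = hd h"
    using hd_P[unfolded dec(2)] hd_P[unfolded dec(3)] dec(4,5) by simp_all
  then have "hd t = hd h" "last t = inv_letter (hd h)"
    using dec(4,5) by (simp_all add: t_def last_inv_word)
  moreover have "t \<in> reduced_words X" "t \<noteq> []"
    using red dec(4) by (simp_all add: t_def)
  ultimately show ?thesis
    using that by blast
qed

text \<open>Two letters \<open>x \<noteq> y\<close> cannot both be the inverse of the last letter of \<open>v\<close>, and they cannot both be
  the first letter of \<open>w\<close>. So words with all four combinations of a first letter in \<open>{x, y}\<close> and a
  last letter in \<open>{x\<^sup>-\<^sup>1, y\<^sup>-\<^sup>1}\<close> suffice.\<close>

lemma exists_connectors: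
  assumes H: "subgroup H G"
    and h: "h \<in> reduced_words X" "val h \<in> H" "h \<noteq> []" "hd h \<noteq> inv_letter (last h)"
    and big: "(n + 1)\<^sup>2 < card (word_ball H n)"
  obtains T where "finite T" "\<And>t. t \<in> T \<Longrightarrow> t \<in> reduced_words X \<and> val t \<in> H"
    "\<And>v w. v \<in> reduced_words X \<Longrightarrow> w \<in> reduced_words X \<Longrightarrow>
       \<exists>t\<in>T. v @ t @ w \<in> reduced_words X"
proof -
  define x y where "x = hd h" and "y = inv_letter (last h)"
  have "x \<noteq> y" using h by (simp add: x_def y_def)
  have hi: "inv_word h \<in> reduced_words X" "val (inv_word h) \<in> H" "inv_word h \<noteq> []"
    "hd (inv_word h) = y" "last (inv_word h) = inv_letter x"
    using h H by (auto simp: val_inv_word reduced_subset_words subgroup.m_inv_closed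
        hd_inv_word last_inv_word x_def y_def)
  obtain s where s: "s \<in> reduced_words X" "val s \<in> H" "s \<noteq> []"
    "hd s = x" "last s = inv_letter x"
    using exists_word_with_inverse_ends[OF H h big] unfolding x_def by blast
  have "hd (inv_word h) \<noteq> inv_letter (last (inv_word h))"
    using hi \<open>x \<noteq> y\<close> by simp
  then obtain r where r: "r \<in> reduced_words X" "val r \<in> H" "r \<noteq> []"
    "hd r = y" "last r = inv_letter y"
    using exists_word_with_inverse_ends[OF H hi(1-3) _ big] unfolding hi(4) by blast
  define T where "T = {h, inv_word h, s, r}"
  have h_ends: "hd h = x" "last h = inv_letter y"
    by (simp_all add: x_def y_def)
  have all_ends: "\<exists>t\<in>T. t \<noteq> [] \<and> hd t = i \<and> last t = inv_letter j"
    if ij: "i \<in> {x, y}" "j \<in> {x, y}" for i j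
  proof -
    consider "i = x" "j = x" | "i = x" "j = y" | "i = y" "j = x" | "i = y" "j = y"
      using ij by blast
    then show ?thesis
    proof cases
      case 1
      with s show ?thesis by (intro bexI[of _ s]) (simp_all add: T_def)
    next
      case 2
      with h(3) h_ends show ?thesis by (intro bexI[of _ h]) (simp_all add: T_def)
    next
      case 3
      with hi show ?thesis by (intro bexI[of _ "inv_word h"]) (simp_all add: T_def)
    next
      case 4
      with r show ?thesis by (intro bexI[of _ r]) (simp_all add: T_def)
    qed
  qed
  have avoid: "\<exists>i\<in>{x, y}. i \<noteq> z" for z
    using \<open>x \<noteq> y\<close> by (cases "x = z") auto
  have T: "t \<in> reduced_words X \<and> val t \<in> H" if "t \<in> T" for t
    using that h(1,2) hi(1,2) s(1,2) r(1,2) unfolding T_def by blast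
  have "\<exists>t\<in>T. v @ t @ w \<in> reduced_words X"
    if vw: "v \<in> reduced_words X" "w \<in> reduced_words X" for v w
  proof -
    obtain i where i: "i \<in> {x, y}" "i \<noteq> inv_letter (last v)"
      using avoid by blast
    obtain j where j: "j \<in> {x, y}" "j \<noteq> hd w"
      using avoid by blast
    obtain t where t: "t \<in> T" "t \<noteq> []" "hd t = i" "last t = inv_letter j"
      using all_ends i(1) j(1) by blast
    have "v @ t @ w \<in> reduced_words X"
      using vw T[OF t(1)] t(2-4) i(2) j(2) by (simp add: reduced_append_iff)
    then show ?thesis using t(1) by blast
  qed
  then show ?thesis using that[of T] T by (simp add: T_def)
qed

text \<open>The word \<open>v @ t @ w\<close> together with the length of \<open>v\<close> and the connector \<open>t\<close> determines the pair
  \<open>(v, w)\<close>. The length of \<open>v\<close> takes \<open>m + 1\<close> values, and the lengths of the connectors are bounded.\<close>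

lemma supermult_of_connectors:
  assumes "finite X" and H: "subgroup H G"
    and "finite T" and T: "\<And>t. t \<in> T \<Longrightarrow> t \<in> reduced_words X \<and> val t \<in> H"
    and connect: "\<And>v w. v \<in> reduced_words X \<Longrightarrow> w \<in> reduced_words X \<Longrightarrow>
       \<exists>t\<in>T. v @ t @ w \<in> reduced_words X"
  obtains K c where "K > 0"
    "\<And>m n. card (word_ball H m) * card (word_ball H n)
       \<le> K * (m + 1) * card (word_ball H (m + n + c))"
proof -
  define c where "c = Max (length ` T)"
  obtain t0 where "t0 \<in> T" using connect[of "[]" "[]"] by auto
  then have "card T > 0" using \<open>finite T\<close> by (auto simp: card_gt_0_iff)
  obtain con where con: "\<And>v w. v \<in> reduced_words X \<Longrightarrow> w \<in> reduced_words X \<Longrightarrow>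
      con v w \<in> T \<and> v @ con v w @ w \<in> reduced_words X"
    using connect by metis
  have "card (word_ball H m) * card (word_ball H n)
      \<le> card T * (m + 1) * card (word_ball H (m + n + c))" for m n
  proof -
    define f where "f = (\<lambda>(v, w). (v @ con v w @ w, length v, con v w))"
    have "f ` (word_ball H m \<times> word_ball H n) \<subseteq> word_ball H (m + n + c) \<times> {..m} \<times> T"
    proof (rule image_subsetI)
      fix p assume "p \<in> word_ball H m \<times> word_ball H n"
      then obtain v w where p: "p = (v, w)" and vw: "v \<in> word_ball H m" "w \<in> word_ball H n"
        by blast
      then have red: "v \<in> reduced_words X" "w \<in> reduced_words X"
        and len: "length v \<le> m" "length w \<le> n" and vals: "val v \<in> H" "val w \<in> H"
        by (auto simp: word_ball_def)
      note c = con[OF red]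
      have "length (con v w) \<le> c"
        unfolding c_def using c \<open>finite T\<close> by simp
      moreover have "val (v @ con v w @ w) = val v \<otimes> (val (con v w) \<otimes> val w)"
        using red T[of "con v w"] c by (simp add: val_append reduced_subset_words)
      then have "val (v @ con v w @ w) \<in> H"
        using vals T[of "con v w"] c H by (simp add: subgroup.m_closed)
      ultimately have "v @ con v w @ w \<in> word_ball H (m + n + c)"
        using c len by (simp add: word_ball_def)
      then show "f p \<in> word_ball H (m + n + c) \<times> {..m} \<times> T"
        using c len by (simp add: f_def p)
    qed
    moreover have "inj_on f (word_ball H m \<times> word_ball H n)"
      by (rule inj_onI) (auto simp: f_def)
    ultimately have "card (word_ball H m \<times> word_ball H n)
        \<le> card (word_ball H (m + n + c) \<times> {..m} \<times> T)"
      using finite_word_ball[OF \<open>finite X\<close>] \<open>finite T\<close> by (intro card_inj_on_le) auto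
    then show ?thesis by (simp add: card_cartesian_product mult_ac)
  qed
  with that \<open>card T > 0\<close> show ?thesis by blast
qed

section \<open>Passing to a conjugate subgroup\<close>

text \<open>A conjugate of minimal length is cyclically reduced: if its first and last letters were
  inverse to each other, then conjugating by the first letter would shorten it by two. A word of
  length one causes no exception, as no letter is its own inverse.\<close>

lemma exists_cyclically_reduced_conjugate:
  assumes "g \<in> carrier G" "g \<noteq> \<one>"
  obtains a h where "a \<in> carrier G" "h \<in> reduced_words X" "val h = inv a \<otimes> g \<otimes> a"
    "h \<noteq> []" "hd h \<noteq> inv_letter (last h)"
proof -
  obtain a where a: "a \<in> carrier G"
    and min: "\<And>b. b \<in> carrier G \<Longrightarrow> len (inv a \<otimes> g \<otimes> a) \<le> len (inv b \<otimes> g \<otimes> b)"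
    using ex_has_least_nat[of "\<lambda>a. a \<in> carrier G" \<one> "\<lambda>a. len (inv a \<otimes> g \<otimes> a)"] by auto
  obtain h where h: "h \<in> reduced_words X" "val h = inv a \<otimes> g \<otimes> a"
    using ex1_reduced[of "inv a \<otimes> g \<otimes> a"] a assms by auto
  have "h \<noteq> []"
  proof
    assume "h = []"
    then have "inv a \<otimes> g \<otimes> a = \<one>" using h by simp
    then have "inv a \<otimes> g = inv a"
      using a assms by (metis inv_closed inv_inv inv_unique' m_closed inv_equality)
    then show False using a assms by (simp add: l_cancel_one')
  qed
  have "hd h \<noteq> inv_letter (last h)"
  proof
    assume eq: "hd h = inv_letter (last h)"
    obtain x w where xw: "h = x # w" using \<open>h \<noteq> []\<close> by (cases h) auto
    have "w \<noteq> []"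
    proof
      assume "w = []"
      then have "x = inv_letter x" using eq xw by simp
      then show False by (metis inv_letter_neq)
    qed
    moreover have "last w = inv_letter x" using eq xw \<open>w \<noteq> []\<close> by simp
    ultimately obtain m where hm: "h = [x] @ m @ inv_word [x]"
      using xw by (metis append_Cons append_Nil append_butlast_last_id inv_word_simps(3))
    then have w: "[x] \<in> words" "m \<in> words"
      using h(1) reduced_subset_words[OF h(1)] by auto
    define b where "b = a \<otimes> val [x]"
    have b: "b \<in> carrier G" using a w by (simp add: b_def)
    have "inv b \<otimes> g \<otimes> b = inv (val [x]) \<otimes> val h \<otimes> val [x]"
      using a w assms by (simp add: b_def h(2) inv_mult_group m_assoc)
    also have "\<dots> = (inv (val [x]) \<otimes> val [x]) \<otimes> val m \<otimes> (inv (val [x]) \<otimes> val [x])"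
      unfolding hm using w by (simp only: val_append val_inv_word append_in_lists_conv
          inv_word_lists m_assoc val_closed m_closed inv_closed)
    also have "\<dots> = val m" using w by simp
    finally have "len (inv b \<otimes> g \<otimes> b) \<le> length m"
      using len_val_le w by simp
    moreover have "len (inv a \<otimes> g \<otimes> a) = length m + 2"
      using len_val[OF h(1)] h(2) hm by simp
    ultimately show False using min[OF b] by simp
  qed
  with that a h \<open>h \<noteq> []\<close> show ?thesis by blast
qed

lemma subgroup_conjugate:
  assumes H: "subgroup H G" and a: "a \<in> carrier G"
  shows "subgroup {g \<in> carrier G. a \<otimes> g \<otimes> inv a \<in> H} G"
proof (rule subgroupI)
  show "{g \<in> carrier G. a \<otimes> g \<otimes> inv a \<in> H} \<noteq> {}"
    using a H by (auto intro!: exI[of _ \<one>] simp: subgroup.one_closed)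
  fix g assume g: "g \<in> {g \<in> carrier G. a \<otimes> g \<otimes> inv a \<in> H}"
  have "a \<otimes> inv g \<otimes> inv a = inv (a \<otimes> g \<otimes> inv a)"
    using a g by (simp add: inv_mult_group m_assoc)
  then show "inv g \<in> {g \<in> carrier G. a \<otimes> g \<otimes> inv a \<in> H}"
    using g H by (simp add: subgroup.m_inv_closed)
  fix k assume k: "k \<in> {g \<in> carrier G. a \<otimes> g \<otimes> inv a \<in> H}"
  have "a \<otimes> (g \<otimes> k) \<otimes> inv a = (a \<otimes> g \<otimes> inv a) \<otimes> (a \<otimes> k \<otimes> inv a)"
  proof -
    have "(a \<otimes> g \<otimes> inv a) \<otimes> (a \<otimes> k \<otimes> inv a) = a \<otimes> g \<otimes> (inv a \<otimes> a) \<otimes> (k \<otimes> inv a)"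
      using a g k by (simp add: m_assoc inv_mult_cancel)
    also have "\<dots> = a \<otimes> (g \<otimes> k) \<otimes> inv a"
      using a g k by (simp add: m_assoc)
    finally show ?thesis by simp
  qed
  then show "g \<otimes> k \<in> {g \<in> carrier G. a \<otimes> g \<otimes> inv a \<in> H}"
    using g k H by (simp add: subgroup.m_closed)
qed auto

lemma growth_function_conjugate_le:
  assumes "finite X" and a: "a \<in> carrier G" and "H \<subseteq> carrier G" "H' \<subseteq> carrier G"
    and conj: "\<And>g. g \<in> H \<Longrightarrow> inv a \<otimes> g \<otimes> a \<in> H'"
  shows "growth_function G X H n \<le> growth_function G X H' (n + 2 * len a)"
  unfolding growth_function_def
proof (rule card_inj_on_le)
  let ?\<phi> = "\<lambda>g. inv a \<otimes> g \<otimes> a"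
  show "inj_on ?\<phi> {g \<in> H. len g \<le> n}"
  proof (rule inj_onI)
    fix g g' assume "g \<in> {g \<in> H. len g \<le> n}" "g' \<in> {g \<in> H. len g \<le> n}"
      and eq: "?\<phi> g = ?\<phi> g'"
    then have "g \<in> carrier G" "g' \<in> carrier G" using assms(3) by auto
    then show "g = g'" using a eq by simp
  qed
  show "?\<phi> ` {g \<in> H. len g \<le> n} \<subseteq> {g \<in> H'. len g \<le> n + 2 * len a}"
  proof (rule image_subsetI)
    fix g assume "g \<in> {g \<in> H. len g \<le> n}"
    then have g: "g \<in> H" "len g \<le> n" "g \<in> carrier G" using assms(3) by auto
    have "len (?\<phi> g) \<le> len (inv a \<otimes> g) + len a" "len (inv a \<otimes> g) \<le> len (inv a) + len g"
      using a g(3) by (simp_all add: len_mult_le)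
    then show "?\<phi> g \<in> {g \<in> H'. len g \<le> n + 2 * len a}"
      using g(2) conj[OF g(1)] len_inv[OF a] by simp
  qed
  show "finite {g \<in> H'. len g \<le> n + 2 * len a}"
    using finite_word_ball[OF assms(1)] by (simp flip: val_image_word_ball[OF assms(4)])
qed

text \<open>The inequality for the conjugate \<open>H'\<close> is transferred to \<open>H\<close> before taking limits: the growth
  functions bound each other up to a shift by \<open>l\<close>, which merely enlarges the constants \<open>K\<close> and \<open>c\<close>.\<close>

theorem growth_rate_exists:
  assumes "finite X" and H: "subgroup H G"
  shows "\<exists>\<alpha>. (\<lambda>n. root n (real (growth_function G X H n))) \<longlonglongrightarrow> \<alpha>"
proof -
  let ?g = "growth_function G X H"
  have HG: "H \<subseteq> carrier G" using H by (rule subgroup.subset)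
  have g_pos: "1 \<le> ?g n" for n
    using card_word_ball_pos[OF assms] growth_function_eq[OF HG] by simp
  show ?thesis
  proof (cases "H = {\<one>}")
    case True
    have "?g n \<le> 1" for n
      unfolding growth_function_def True
      by (rule order_trans[OF card_mono[of "{\<one>}"]]) auto
    moreover have "1 \<le> (real n + 1)\<^sup>2" for n
      by simp
    ultimately have "real (?g n) \<le> (real n + 1)\<^sup>2" for n
      by (meson of_nat_le_1_iff order_trans)
    then show ?thesis
      using root_tendsto_1_of_quadratic[of "\<lambda>n. real (?g n)" 1] g_pos by fastforce
  next
    case False
    then obtain k where k: "k \<in> H" "k \<noteq> \<one>"
      using subgroup.one_closed[OF H] by auto
    obtain a h where a: "a \<in> carrier G" and h: "h \<in> reduced_words X"
      and val_h: "val h = inv a \<otimes> k \<otimes> a" and h': "h \<noteq> []" "hd h \<noteq> inv_letter (last h)"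
      using exists_cyclically_reduced_conjugate[of k] k HG by blast
    define H' where "H' = {g \<in> carrier G. a \<otimes> g \<otimes> inv a \<in> H}"
    have H': "subgroup H' G"
      unfolding H'_def by (rule subgroup_conjugate[OF H a])
    have H'G: "H' \<subseteq> carrier G" by (auto simp: H'_def)
    have conj: "inv a \<otimes> g \<otimes> a \<in> H'" if "g \<in> H" for g
    proof -
      have g: "g \<in> carrier G" using that HG by auto
      have "a \<otimes> (inv a \<otimes> g \<otimes> a) \<otimes> inv a = (a \<otimes> inv a) \<otimes> g \<otimes> (a \<otimes> inv a)"
        using a g by (simp only: m_assoc m_closed inv_closed)
      also have "\<dots> = g" using a g by simp
      finally show ?thesis using a g that by (simp add: H'_def)
    qed
    let ?g' = "growth_function G X H'"
    define l where "l = 2 * len a"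
    have g_le: "?g n \<le> ?g' (n + l)" for n
      unfolding l_def using growth_function_conjugate_le[OF \<open>finite X\<close> a HG H'G conj] by blast
    have g'_le: "?g' n \<le> ?g (n + l)" for n
      unfolding l_def
      using growth_function_conjugate_le[OF \<open>finite X\<close> _ H'G HG, of "inv a"] a len_inv[OF a]
      by (auto simp: H'_def)
    note g'_eq = growth_function_eq[OF H'G]
    show ?thesis
    proof (cases "\<exists>n. (n + 1)\<^sup>2 < ?g' n")
      case False
      have "real (?g n) \<le> (real n + (real l + 1))\<^sup>2" for n
      proof -
        have "?g n \<le> (n + l + 1)\<^sup>2"
          using g_le[of n] False by (meson not_less order_trans)
        then have "real (?g n) \<le> real ((n + l + 1)\<^sup>2)"
          by (rule of_nat_mono)
        then show ?thesis by (simp add: add_ac)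
      qed
      then show ?thesis
        using root_tendsto_1_of_quadratic[of "\<lambda>n. real (?g n)" "real l + 1"] g_pos by fastforce
    next
      case True
      then obtain n where big: "(n + 1)\<^sup>2 < card (word_ball H' n)"
        unfolding g'_eq by blast
      have "val h \<in> H'" using conj[OF k(1)] val_h by simp
      then obtain T where T: "finite T" "\<And>t. t \<in> T \<Longrightarrow> t \<in> reduced_words X \<and> val t \<in> H'"
        "\<And>v w. v \<in> reduced_words X \<Longrightarrow> w \<in> reduced_words X \<Longrightarrow>
          \<exists>t\<in>T. v @ t @ w \<in> reduced_words X"
        using exists_connectors[OF H' h _ h' big] by blast
      obtain K c where "K > 0" and supermult: "\<And>m n. card (word_ball H' m) * card (word_ball H' n)
          \<le> K * (m + 1) * card (word_ball H' (m + n + c))"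
        using supermult_of_connectors[OF \<open>finite X\<close> H' T] by blast
      have supermult_g: "?g m * ?g n \<le> K * (l + 1) * (m + 1) * ?g (m + n + (3 * l + c))" for m n
      proof -
        have "?g m * ?g n \<le> ?g' (m + l) * ?g' (n + l)"
          using g_le by (intro mult_mono) auto
        also have "\<dots> \<le> K * (m + l + 1) * ?g' (m + l + (n + l) + c)"
          using supermult unfolding g'_eq by blast
        also have "\<dots> \<le> (K * ((l + 1) * (m + 1))) * ?g (m + l + (n + l) + c + l)"
          by (intro mult_mono g'_le) (auto simp: algebra_simps)
        also have "m + l + (n + l) + c + l = m + n + (3 * l + c)" by simp
        finally show ?thesis by (simp only: mult.assoc)
      qed
      show ?thesis
      proof (rule root_tendsto_of_quasi_supermult)
        show "mono (\<lambda>n. real (?g n))"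
        proof (rule monoI)
          fix m n :: nat assume "m \<le> n"
          then show "real (?g m) \<le> real (?g n)"
            unfolding growth_function_eq[OF HG]
            by (intro of_nat_mono card_mono finite_word_ball \<open>finite X\<close>) (auto simp: word_ball_def)
        qed
        show "1 \<le> real (?g n)" for n using g_pos[of n] by simp
        show "real (?g n) \<le> (real (2 * card X + 1)) ^ n" for n
          using card_word_ball_le[OF \<open>finite X\<close>, of H n] growth_function_eq[OF HG, of n]
          by (metis of_nat_mono of_nat_power)
        show "real (K * (l + 1)) > 0"
          using \<open>K > 0\<close> by (simp only: of_nat_0_less_iff) simp
        show "real (?g m) * real (?g n)
            \<le> real (K * (l + 1)) * real (m + 1) * real (?g (m + n + (3 * l + c)))" for m n
          using supermult_g[of m n] by (metis of_nat_mono of_nat_mult)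
      qed
    qed
  qed
qed

end

theorem theorem1p5:
  fixes G :: "('a, 'm) monoid_scheme" and X H :: "'a set"
  assumes "group G"
    and "free_basis G X"
    and "finite X"
    and "subgroup H G"
  shows "\<exists>\<alpha>::real. (\<lambda>n. root n (real (growth_function G X H n))) \<longlonglongrightarrow> \<alpha>"
proof -
  interpret free_group G X
    using assms(1,2) by (simp add: free_group_def free_group_axioms_def)
  show ?thesis using growth_rate_exists[OF assms(3,4)] .
qed

end
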